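(* Let $M>1$, $\mathcal R=[1/M,M]$, $\hat{\boldsymbol x}\in\mathcal R^2\times\mathbb R$, $\delta>0$, let $s$ be a positive integer and $\hat\psi_{2s}(y)=\sum_{i=0}^{2s}\frac{y^i}{i!}$. For a positive integer $N$ let $$\hat K^{sc,sft}_{\overline\psi,N,2s}=\Big\{\boldsymbol x\in\mathcal R^2\times\mathbb R:\ \frac{x_1}{x_2}\ge\exp\Big(\frac{\hat x_3}{\hat x_2}\Big)\Big(\hat\psi_{2s}\big(2^{-N}(x_3/x_2-\hat x_3/\hat x_2)\big)\Big)^{2^N}\Big\}.$$ For every $\epsilon\in(0,\delta]$ one can choose $N=O\big(\log(\delta/s)+\log(1/\epsilon)/s\big)$ such that, restricted to $\boldsymbol x$ with $|x_3/x_2-\hat x_3/\hat x_2|\le\delta$, $$K_{\exp}(-\epsilon)\subseteq\hat K^{sc,sft}_{\overline\psi,N,2s}\subseteq K_{\exp}(\epsilon).$$ In particular, for $s=1$, $\hat K^{sc,sft}_{\overline\psi,N,2}$ is the set of $\boldsymbol x\in\mathcal R^2\times\mathbb R$ for which there exist $r_1,\dots,r_N\in\mathbb R$ with $$r_k\ge0\ \ \forall k\in[N-1],\quad \big(2r_1\sqrt{\exp(\hat x_3/\hat x_2)},\,x_1-x_2,\,x_1+x_2\big)\in\mathcal L_3,$$ $$(2r_{k+1},r_k-x_2,r_k+x_2)\in\mathcal L_3\ \ \forall k\in[N-1],\quad \big(x_2+2^{-N}(x_3-x_2(\hat x_3/\hat x_2)),\,r_N-x_2,\,r_N\big)\in\mathcal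 L_3 .$$
   Context: $[n]=\{1,\dots,n\}$ (empty for $n=0$); $\mathcal L_3=\{y\in\mathbb R^3:y_3\ge\sqrt{y_1^2+y_2^2}\}$. For $\alpha\in\mathbb R$, $K_{\exp}(\alpha)=\{\boldsymbol x\in\mathcal R^2\times\mathbb R:\ x_1/x_2\ge\exp(x_3/x_2-\alpha)\}$. "Restricted to" means intersecting each set in the chain of inclusions with the indicated set of $\boldsymbol x$. $O(\cdot)$ is the usual asymptotic notation, describing growth in $\delta$ and $1/\epsilon$ for given $s$. *)

theory Defs
  imports "HOL-Analysis.Analysis" "HOL-Library.Landau_Symbols"
begin

definition L3 :: "(real^3) set" where
  "L3 = {y. y $ 3 \<ge> sqrt ((y $ 1)\<^sup>2 + (y $ 2)\<^sup>2)}"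

text \<open>\<open>box_dom M\<close> is \<open>R\<^sup>2 \<times> \<real>\<close> for \<open>R = [1/M, M]\<close>, as a subset of \<open>\<real>\<^sup>3\<close>.\<close>

definition box_dom :: "real \<Rightarrow> (real^3) set" where
  "box_dom M = {x. x $ 1 \<in> {1 / M..M} \<and> x $ 2 \<in> {1 / M..M}}"

definition K_exp :: "real \<Rightarrow> real \<Rightarrow> (real^3) set" where
  "K_exp M \<alpha> = {x \<in> box_dom M. x $ 1 / x $ 2 \<ge> exp (x $ 3 / x $ 2 - \<alpha>)}"

definition psi_hat :: "nat \<Rightarrow> real \<Rightarrow> real" where
  "psi_hat n y = (\<Sum>i\<le>n. y ^ i / fact i)"

definition K_sc :: "real \<Rightarrow> real^3 \<Rightarrow> nat \<Rightarrow> nat \<Rightarrow> (real^3) set" where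
  "K_sc M xh N n = {x \<in> box_dom M.
     x $ 1 / x $ 2 \<ge> exp (xh $ 3 / xh $ 2) *
       psi_hat n ((x $ 3 / x $ 2 - xh $ 3 / xh $ 2) / 2 ^ N) ^ (2 ^ N)}"

definition slab :: "real^3 \<Rightarrow> real \<Rightarrow> (real^3) set" where
  "slab xh \<delta> = {x. \<bar>x $ 3 / x $ 2 - xh $ 3 / xh $ 2\<bar> \<le> \<delta>}"

text \<open>The filter for an asymptotic bound in two parameters \<open>(a, b)\<close> that both stay \<open>\<ge> \<kappa>\<close>
  while at least one of them tends to infinity.  It is coarser than
  \<open>at_top \<times>\<^sub>F at_top\<close>, and also covers growth in one parameter with the other one held fixed.\<close>

definition growth_filter :: "real \<Rightarrow> (real \<times> real) filter" where
  "growth_filter \<kappa> = sup (principal {\<kappa>..} \<times>\<^sub>F at_top) (at_top \<times>\<^sub>F principal {\<kappa>..})"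

end

theory Submission
  imports Defs
begin

text \<open>
  Write \<open>z = y / 2^N\<close>.  For \<open>\<bar>z\<bar> \<le> 1/2\<close> the Taylor remainder gives
  \<open>\<bar>ln (\<psi>\<^sub>2\<^sub>s(z)) - z\<bar> \<le> \<bar>z\<bar>^(2s+1)\<close>, so the logarithm of \<open>\<psi>\<^sub>2\<^sub>s(z)^(2^N)\<close> differs from \<open>y\<close> by at
  most \<open>\<delta> (\<delta> / 2^N)^(2s)\<close>.  Both this being \<open>\<le> \<epsilon>\<close> and \<open>\<delta> / 2^N \<le> 1/2\<close> hold as soon as
  \<open>2^N \<ge> 2 \<delta> (\<delta>/\<epsilon>)^(1/(2s))\<close>.
  For \<open>s = 1\<close>, \<open>\<psi>\<^sub>2(z) = ((1 + z)\<^sup>2 + 1) / 2\<close>, so the inequality unfolds into one quadratic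
  constraint and \<open>N\<close> successive squarings, each of which is a rotated second-order cone constraint.
\<close>

section \<open>Taylor error on the logarithmic scale and the resulting inclusions\<close>

text \<open>Dividing the Lagrange remainder by \<open>exp z\<close> gives
  \<open>psi_hat n z = exp z * (1 + u)\<close>, so the error is exactly \<open>ln (1 + u)\<close>.
  It is at most \<open>\<bar>u\<bar> + 2 * u^2\<close>, hence at most 3/2 of
  \<open>\<bar>u\<bar>\<close>, while \<open>\<bar>u\<bar>\<close> is at most half of
  \<open>\<bar>z\<bar> ^ (n + 1)\<close>.\<close>

lemma psi_hat_ln_error:
  assumes n: "n \<ge> 2" and z: "\<bar>z\<bar> \<le> 1/2"
  shows "psi_hat n z > 0" "\<bar>ln (psi_hat n z) - z\<bar> \<le> \<bar>z\<bar> ^ (n + 1)"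
proof -
  obtain t where t: "\<bar>t\<bar> \<le> \<bar>z\<bar>"
    and exp_z: "exp z = (\<Sum>m<n+1. z ^ m / fact m) + exp t / fact (n+1) * z ^ (n+1)"
    using Maclaurin_exp_le by blast
  define u where "u = - (exp (t - z) / fact (n+1) * z ^ (n+1))"
  have "psi_hat n z = exp z - exp t / fact (n+1) * z ^ (n+1)"
    using exp_z by (simp add: psi_hat_def lessThan_Suc_atMost)
  also have "\<dots> = exp z * (1 + u)"
    by (simp add: u_def exp_diff right_diff_distrib del: fact_Suc)
  finally have psi: "psi_hat n z = exp z * (1 + u)" .
  \<comment> \<open>Both \<open>t\<close> and \<open>z\<close> have absolute value at most 1/2, so
    \<open>t - z\<close> is at most 1.\<close>
  have "exp (t - z) \<le> exp 1"
    using t z by simp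
  then have e3: "exp (t - z) \<le> 3"
    using exp_le by linarith
  have "(fact 3 :: real) \<le> fact (n+1)"
    using n by (intro fact_mono) auto
  then have f6: "(fact (n+1) :: real) \<ge> 6"
    by (simp add: fact_numeral)
  have "exp (t - z) / fact (n+1) \<le> 3 / 6"
    using e3 f6 by (intro frac_le) auto
  then have "exp (t - z) / fact (n+1) * \<bar>z\<bar> ^ (n+1) \<le> 1/2 * \<bar>z\<bar> ^ (n+1)"
    by (intro mult_right_mono) auto
  then have u: "\<bar>u\<bar> \<le> \<bar>z\<bar> ^ (n+1) / 2"
    by (simp add: u_def abs_mult power_abs)
  have "\<bar>z\<bar> ^ (n+1) \<le> \<bar>z\<bar> ^ 1"
    using z by (intro power_decreasing) auto
  then have u4: "\<bar>u\<bar> \<le> 1/4"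
    using u z by simp
  show "psi_hat n z > 0"
    unfolding psi using u4 by (intro mult_pos_pos) auto
  have "ln (psi_hat n z) = z + ln (1 + u)"
    unfolding psi using u4 by (subst ln_mult) auto
  moreover have "\<bar>ln (1 + u) - u\<bar> \<le> 2 * u\<^sup>2"
    using u4 by (intro abs_ln_one_plus_x_minus_x_bound) auto
  moreover have "u\<^sup>2 \<le> 1/4 * \<bar>u\<bar>"
    using mult_right_mono[OF u4, of "\<bar>u\<bar>"] by (simp add: power2_eq_square)
  ultimately show "\<bar>ln (psi_hat n z) - z\<bar> \<le> \<bar>z\<bar> ^ (n + 1)"
    using u by linarith
qed

lemma psi_hat_scaled_error:
  assumes n: "n \<ge> 2" and y: "\<bar>y\<bar> \<le> \<delta>" and small: "\<delta> / 2 ^ N \<le> 1/2"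
    and \<epsilon>: "\<delta> * (\<delta> / 2 ^ N) ^ n \<le> \<epsilon>"
  shows "psi_hat n (y / 2 ^ N) ^ 2 ^ N \<in> {exp (y - \<epsilon>)..exp (y + \<epsilon>)}"
proof -
  define z where "z = y / 2 ^ N"
  have z\<delta>: "\<bar>z\<bar> \<le> \<delta> / 2 ^ N"
    using y by (simp add: z_def divide_right_mono)
  then have z: "\<bar>z\<bar> \<le> 1/2"
    using small by linarith
  note err = psi_hat_ln_error[OF n z]
  have pow: "psi_hat n z ^ 2 ^ N = exp (2 ^ N * ln (psi_hat n z))"
    using err(1) exp_of_nat_mult[of "2 ^ N" "ln (psi_hat n z)"] by simp
  have "2 ^ N * ln (psi_hat n z) - y = 2 ^ N * (ln (psi_hat n z) - z)"
    by (simp add: z_def right_diff_distrib)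
  then have "\<bar>2 ^ N * ln (psi_hat n z) - y\<bar> = 2 ^ N * \<bar>ln (psi_hat n z) - z\<bar>"
    by (simp add: abs_mult)
  also have "\<dots> \<le> 2 ^ N * (\<delta> / 2 ^ N) ^ (n+1)"
    using err(2) power_mono[OF z\<delta>, of "n+1"] by (intro mult_left_mono) auto
  also have "\<dots> = \<delta> * (\<delta> / 2 ^ N) ^ n"
    by simp
  finally have "\<bar>2 ^ N * ln (psi_hat n z) - y\<bar> \<le> \<epsilon>"
    using \<epsilon> by linarith
  then show ?thesis
    by (auto simp: pow simp flip: z_def)
qed

text \<open>Multiplying the error bounds by \<open>exp (xh $ 3 / xh $ 2)\<close> replaces
  \<open>y\<close> by \<open>x $ 3 / x $ 2\<close>. The right-hand side defining \<open>K_sc\<close>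
  thus lies between those defining \<open>K_exp M \<epsilon>\<close> and
  \<open>K_exp M (- \<epsilon>)\<close>. A larger right-hand side gives a smaller set, so the upper
  bound yields the first inclusion.\<close>

lemma K_sc_sandwich:
  assumes n: "n \<ge> 2" and small: "\<delta> / 2 ^ N \<le> 1/2" and \<epsilon>: "\<delta> * (\<delta> / 2 ^ N) ^ n \<le> \<epsilon>"
  shows "K_exp M (- \<epsilon>) \<inter> slab xh \<delta> \<subseteq> K_sc M xh N n \<inter> slab xh \<delta>"
    and "K_sc M xh N n \<inter> slab xh \<delta> \<subseteq> K_exp M \<epsilon> \<inter> slab xh \<delta>"
proof -
  have bounds:
    "exp (x $ 3 / x $ 2 - \<epsilon>) \<le> exp (xh $ 3 / xh $ 2) *
       psi_hat n ((x $ 3 / x $ 2 - xh $ 3 / xh $ 2) / 2 ^ N) ^ 2 ^ N"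
    "exp (xh $ 3 / xh $ 2) *
       psi_hat n ((x $ 3 / x $ 2 - xh $ 3 / xh $ 2) / 2 ^ N) ^ 2 ^ N \<le> exp (x $ 3 / x $ 2 + \<epsilon>)"
    if "x \<in> slab xh \<delta>" for x
  proof -
    define h y where "h = xh $ 3 / xh $ 2" and "y = x $ 3 / x $ 2 - h"
    have "\<bar>y\<bar> \<le> \<delta>"
      using that by (simp add: slab_def y_def h_def)
    from psi_hat_scaled_error[OF n this small \<epsilon>]
    have "exp h * exp (y - \<epsilon>) \<le> exp h * psi_hat n (y / 2 ^ N) ^ 2 ^ N"
      and "exp h * psi_hat n (y / 2 ^ N) ^ 2 ^ N \<le> exp h * exp (y + \<epsilon>)"
      by auto
    then show "exp (x $ 3 / x $ 2 - \<epsilon>) \<le> exp (xh $ 3 / xh $ 2) *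
       psi_hat n ((x $ 3 / x $ 2 - xh $ 3 / xh $ 2) / 2 ^ N) ^ 2 ^ N"
      and "exp (xh $ 3 / xh $ 2) *
       psi_hat n ((x $ 3 / x $ 2 - xh $ 3 / xh $ 2) / 2 ^ N) ^ 2 ^ N \<le> exp (x $ 3 / x $ 2 + \<epsilon>)"
      by (simp_all add: y_def h_def flip: exp_add)
  qed
  show "K_exp M (- \<epsilon>) \<inter> slab xh \<delta> \<subseteq> K_sc M xh N n \<inter> slab xh \<delta>"
    using bounds(2) unfolding K_exp_def K_sc_def by fastforce
  show "K_sc M xh N n \<inter> slab xh \<delta> \<subseteq> K_exp M \<epsilon> \<inter> slab xh \<delta>"
    using bounds(1) unfolding K_exp_def K_sc_def by fastforce
qed

section \<open>The required number of squarings and its growth\<close>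

text \<open>The binary logarithm of \<open>\<delta> (\<delta> t)^(1/(2s))\<close>, where \<open>t = 1/\<epsilon>\<close>.\<close>

definition depth :: "nat \<Rightarrow> real \<times> real \<Rightarrow> real" where
  "depth s = (\<lambda>(\<delta>, t). log 2 \<delta> + (log 2 \<delta> + log 2 t) / (2 * real s))"

text \<open>In base-2 logarithms both claims are linear in \<open>N\<close>. As \<epsilon> \<le>
  \<delta>, the fraction in \<open>depth\<close> is nonnegative, so the summand 1 alone gives
  \<open>\<delta> / 2 ^ N \<le> 1/2\<close>. Multiplying the hypothesis on \<open>N\<close> by
  \<open>2 * s\<close> gives the other claim with slack \<open>2 * s\<close>.\<close>

lemma depth_sufficient:
  assumes s: "s \<ge> 1" and \<epsilon>: "0 < \<epsilon>" "\<epsilon> \<le> \<delta>" and N: "real N \<ge> 1 + depth s (\<delta>, 1 / \<epsilon>)"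
  shows "\<delta> / 2 ^ N \<le> 1/2" "\<delta> * (\<delta> / 2 ^ N) ^ (2 * s) \<le> \<epsilon>"
proof -
  have \<delta>: "\<delta> > 0"
    using \<epsilon> by linarith
  define a e where "a = log 2 \<delta>" and "e = log 2 \<epsilon>"
  have ae: "a \<ge> e"
    using \<epsilon> \<delta> by (simp add: a_def e_def)
  have N': "real N \<ge> 1 + a + (a - e) / (2 * real s)"
    using N \<epsilon> by (simp add: depth_def a_def e_def log_divide)
  then have N1: "a - real N \<le> -1"
    using ae by (smt (verit) divide_nonneg_nonneg of_nat_0_le_iff)
  have frac: "\<delta> / 2 ^ N = 2 powr (a - real N)"
    using \<delta> by (simp add: a_def powr_diff powr_realpow)
  also have "\<dots> \<le> 2 powr (-1)"
    using N1 by (intro powr_mono) auto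
  finally show "\<delta> / 2 ^ N \<le> 1/2"
    by (simp add: powr_minus_divide)
  have "2 * real s * (1 + a - real N) + (a - e) =
        2 * real s * (1 + a + (a - e) / (2 * real s) - real N)"
    using s by (simp add: field_simps)
  also have "\<dots> \<le> 0"
    using N' by (intro mult_nonneg_nonpos) auto
  finally have le: "a + (a - real N) * (2 * real s) \<le> e"
    using s by (simp add: algebra_simps)
  have "\<delta> * (\<delta> / 2 ^ N) ^ (2 * s) = 2 powr a * 2 powr ((a - real N) * (2 * real s))"
    unfolding frac using \<delta> by (simp add: a_def powr_powr flip: powr_realpow)
  also have "\<dots> = 2 powr (a + (a - real N) * (2 * real s))"
    by (simp add: powr_add)
  also have "\<dots> \<le> 2 powr e"
    using le by (intro powr_mono) auto
  also have "\<dots> = \<epsilon>"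
    using \<epsilon> by (simp add: e_def)
  finally show "\<delta> * (\<delta> / 2 ^ N) ^ (2 * s) \<le> \<epsilon>" .
qed

text \<open>Each half of the filter supplies one disjunct; the threshold
  \<open>max \<kappa> L\<close> makes the growing coordinate also exceed \<kappa>.\<close>

lemma eventually_growth_filter_large:
  "eventually (\<lambda>(x, y). \<kappa> \<le> x \<and> \<kappa> \<le> y \<and> (L \<le> x \<or> L \<le> y)) (growth_filter \<kappa>)"
proof -
  have "eventually (\<lambda>(x, y). \<kappa> \<le> x \<and> max \<kappa> L \<le> y) (principal {\<kappa>..} \<times>\<^sub>F at_top)"
    unfolding case_prod_beta
    by (intro eventually_prodI eventually_ge_at_top) (simp add: eventually_principal)
  moreover have "eventually (\<lambda>(x, y). max \<kappa> L \<le> x \<and> \<kappa> \<le> y) (at_top \<times>\<^sub>F principal {\<kappa>..})"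
    unfolding case_prod_beta
    by (intro eventually_prodI eventually_ge_at_top) (simp add: eventually_principal)
  ultimately show ?thesis
    unfolding growth_filter_def eventually_sup by (auto elim!: eventually_mono)
qed

text \<open>With \<open>a = ln \<delta>\<close>, \<open>b = ln t\<close>, \<open>i = 1 / s\<close>,
  the comparison function is \<open>G - l\<close> for \<open>G = a + i * b\<close>, and
  \<open>depth\<close> is \<open>X / ln 2\<close> for \<open>X = a + (a + b) * i / 2\<close>.
  Doubling \<open>G\<close> dominates both coefficients of \<open>X\<close>; the additive constants
  are absorbed once \<open>G\<close> is large.\<close>

lemma depth_bigo:
  assumes s: "s \<ge> 1" and \<kappa>: "\<kappa> > 0"
  shows "(\<lambda>p. 3 + max 0 (depth s p)) \<in>
           O[growth_filter \<kappa>](\<lambda>(\<delta>, t). ln (\<delta> / real s) + ln t / real s)"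
proof (rule landau_o.bigI[of 8])
  \<comment> \<open>\<open>c\<close> limits how negative \<open>ln \<delta>\<close> and
    \<open>ln t\<close> can be while both arguments stay above \<kappa>.\<close>
  define c where "c = max 0 (- ln \<kappa>)"
  define l where "l = ln (real s)"
  \<comment> \<open>The factor \<open>s\<close> compensates for the weight \<open>1 / s\<close> of
    \<open>ln t\<close>, so that \<open>G\<close> is at least \<open>3 + 11 * c + 8 * l\<close>
    whichever argument is the large one.\<close>
  define L where "L = real s * (3 + 12 * c + 8 * l)"
  have c: "c \<ge> 0" and lns: "l \<ge> 0"
    using s by (simp_all add: c_def l_def)
  define i where "i = 1 / real s"
  have i: "0 < i" "i \<le> 1"
    using s by (simp_all add: i_def)
  have Li: "L * i = 3 + 12 * c + 8 * l"
    using s by (simp add: L_def i_def)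
  have L0: "L \<ge> 0"
    using c lns by (simp add: L_def)
  show "eventually (\<lambda>p. norm (3 + max 0 (depth s p)) \<le>
          8 * norm ((\<lambda>(\<delta>, t). ln (\<delta> / real s) + ln t / real s) p)) (growth_filter \<kappa>)"
    using eventually_growth_filter_large[of \<kappa> "exp L"]
  proof eventually_elim
    case (elim p)
    obtain \<delta> t where p: "p = (\<delta>, t)"
      by force
    have ge: "\<kappa> \<le> \<delta>" "\<kappa> \<le> t" "exp L \<le> \<delta> \<or> exp L \<le> t"
      using elim by (auto simp: p)
    then have pos: "\<delta> > 0" "t > 0"
      using \<kappa> by auto
    define a b where "a = ln \<delta>" and "b = ln t"
    have "ln \<kappa> \<le> a" "ln \<kappa> \<le> b"
      using ge \<kappa> pos by (simp_all add: a_def b_def)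
    then have ab: "a \<ge> - c" "b \<ge> - c"
      by (auto simp: c_def)
    have L: "L \<le> a \<or> L \<le> b"
      using ge(3) pos by (auto simp: a_def b_def ln_ge_iff)
    have "i * c \<le> 1 * c" "i * L \<le> 1 * L"
      using i c L0 by (intro mult_right_mono; simp)+
    then have ic: "i * c \<le> c" and iL: "i * L \<le> L"
      by simp_all
    have ib: "i * b \<ge> - (i * c)"
      using mult_left_mono[OF ab(2), of i] i by simp
    have large: "a + i * b \<ge> L * i - c"
      using L
    proof
      assume "L \<le> a"
      then show ?thesis
        using ib ic iL by (simp add: mult.commute)
    next
      assume "L \<le> b"
      then have "i * L \<le> i * b"
        using i by (intro mult_left_mono) auto
      then show ?thesis
        using ab by (simp add: mult.commute)
    qed
    \<comment> \<open>The factor \<open>1 - i / 2\<close> is the coefficient of \<open>a\<close>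
      left in \<open>2 * G - X\<close>.\<close>
    have "(1 - i / 2) * a \<ge> (1 - i / 2) * (- c)"
      using ab i by (intro mult_left_mono) auto
    then have "a + (a + b) * i / 2 \<le> 2 * (a + i * b) + 2 * c"
      using ib ic by (simp add: algebra_simps)
    moreover define X G where "X = a + (a + b) * i / 2" and "G = a + i * b"
    ultimately have E: "X \<le> 2 * G + 2 * c"
      by simp
    have G: "3 + 11 * c + 8 * l \<le> G"
      using large Li by (simp add: G_def)
    \<comment> \<open>This turns division by \<open>ln 2\<close> into a factor 2. It is
      \<open>ln (1 + x) \<le> x\<close> at \<open>x = -1/2\<close>.\<close>
    have ln2: "ln 2 \<ge> (1/2 :: real)"
      using ln_add_one_self_le_self2[of "-1/2::real"] by (simp add: ln_div)
    have "depth s p = X / ln 2"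
      by (simp add: X_def p depth_def a_def b_def i_def log_def add_divide_distrib mult_ac)
    also have "\<dots> \<le> max 0 X / ln 2"
      by (intro divide_right_mono) auto
    also have "\<dots> \<le> max 0 X / (1/2)"
      using ln2 by (intro divide_left_mono) auto
    finally have "max 0 (depth s p) \<le> 2 * max 0 X"
      by simp
    also have "\<dots> \<le> 4 * G + 4 * c"
      using E G c lns by simp
    finally have "3 + max 0 (depth s p) \<le> 8 * G - 8 * l"
      using G c lns by linarith
    then have "3 + max 0 (depth s p) \<le> 8 * (G - l)"
      by (simp add: right_diff_distrib)
    moreover have "ln (\<delta> / real s) + ln t / real s = G - l"
      using pos s by (simp add: G_def a_def b_def i_def l_def ln_div)
    ultimately show ?case
      by (simp add: p)
  qed
qed simp

section \<open>Second-order cone representation for \<open>s = 1\<close>\<close>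

lemma sqrt_sum_squares_le_iff:
  fixes a b c :: real
  shows "sqrt (a\<^sup>2 + b\<^sup>2) \<le> c \<longleftrightarrow> 0 \<le> c \<and> a\<^sup>2 + b\<^sup>2 \<le> c\<^sup>2"
proof
  assume le: "sqrt (a\<^sup>2 + b\<^sup>2) \<le> c"
  moreover have "0 \<le> sqrt (a\<^sup>2 + b\<^sup>2)"
    by simp
  ultimately show "0 \<le> c \<and> a\<^sup>2 + b\<^sup>2 \<le> c\<^sup>2"
    using sqrt_le_D[OF le] by linarith
qed (auto intro: real_le_lsqrt)

text \<open>The identity \<open>(u + v)^2 - (u - v)^2 = 4 * u * v\<close> identifies this as a
  rotated second-order cone.\<close>

lemma rotated_cone_iff:
  "vector [2 * p, u - v, u + v] \<in> L3 \<longleftrightarrow> 0 \<le> u + v \<and> p\<^sup>2 \<le> u * v"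
proof -
  have "vector [2 * p, u - v, u + v] \<in> L3 \<longleftrightarrow> sqrt ((2 * p)\<^sup>2 + (u - v)\<^sup>2) \<le> u + v"
    by (simp add: L3_def vector_3)
  also have "\<dots> \<longleftrightarrow> 0 \<le> u + v \<and> (2 * p)\<^sup>2 + (u - v)\<^sup>2 \<le> (u + v)\<^sup>2"
    by (rule sqrt_sum_squares_le_iff)
  also have "(2 * p)\<^sup>2 + (u - v)\<^sup>2 \<le> (u + v)\<^sup>2 \<longleftrightarrow> p\<^sup>2 \<le> u * v"
    by (simp add: power2_eq_square algebra_simps)
  finally show ?thesis .
qed

lemma psi_hat_2: "psi_hat 2 z = ((1 + z)\<^sup>2 + 1) / 2"
  by (simp add: psi_hat_def numeral_2_eq_2 power2_eq_square field_simps)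

text \<open>Cancelling \<open>r^2\<close> leaves \<open>(v + v * z)^2 + v^2 \<le> 2 * v * r\<close>,
  whose left side is \<open>2 * v^2 * psi_hat 2 z\<close>. Positivity of \<open>psi_hat 2 z\<close>
  then forces \<open>r\<close> to be nonnegative.\<close>

lemma psi_hat_2_cone_iff:
  assumes v: "v > 0"
  shows "vector [v + v * z, r - v, r] \<in> L3 \<longleftrightarrow> v * psi_hat 2 z \<le> r"
proof -
  have "vector [v + v * z, r - v, r] \<in> L3 \<longleftrightarrow> sqrt ((v + v * z)\<^sup>2 + (r - v)\<^sup>2) \<le> r"
    by (simp add: L3_def vector_3)
  also have "\<dots> \<longleftrightarrow> 0 \<le> r \<and> (v + v * z)\<^sup>2 + (r - v)\<^sup>2 \<le> r\<^sup>2"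
    by (rule sqrt_sum_squares_le_iff)
  also have "(v + v * z)\<^sup>2 + (r - v)\<^sup>2 \<le> r\<^sup>2 \<longleftrightarrow> 2 * v * (v * psi_hat 2 z) \<le> 2 * v * r"
  proof -
    have "2 * v * (v * psi_hat 2 z) = (v + v * z)\<^sup>2 + v\<^sup>2"
      by (simp add: psi_hat_2 power2_eq_square field_simps)
    then show ?thesis
      by (simp add: power2_diff mult_ac) linarith
  qed
  also have "\<dots> \<longleftrightarrow> v * psi_hat 2 z \<le> r"
    using v by simp
  also have "0 \<le> r \<and> v * psi_hat 2 z \<le> r \<longleftrightarrow> v * psi_hat 2 z \<le> r"
    using v order_trans[of 0 "v * psi_hat 2 z" r] by (auto simp: psi_hat_2)
  finally show ?thesis .
qed

text \<open>The variable \<open>r k\<close> is an upper bound for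
  \<open>v * P ^ 2 ^ (N - k)\<close>: each step down in \<open>k\<close> squares the power of
  \<open>P\<close>, and the constraint on \<open>r 1\<close> performs the last squaring and compares
  with \<open>u\<close>.\<close>

lemma squaring_chain_iff:
  fixes u v a P :: real
  assumes v: "v > 0" and a: "a > 0" and P: "P > 0" and N: "N \<ge> 1"
  shows "a * P ^ 2 ^ N \<le> u / v \<longleftrightarrow>
    (\<exists>r. (\<forall>k\<in>{1..N - 1}. r k \<ge> 0) \<and> (r 1 * sqrt a)\<^sup>2 \<le> u * v \<and>
         (\<forall>k\<in>{1..N - 1}. (r (k + 1))\<^sup>2 \<le> r k * v) \<and> v * P \<le> r N)"
    (is "?L \<longleftrightarrow> ?R")
proof
  assume ?L
  \<comment> \<open>This choice makes the step constraints and the bound on \<open>r N\<close>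
    equalities; the constraint on \<open>r 1\<close> becomes the assumed inequality times
    \<open>v^2\<close>.\<close>
  define r where "r k = v * P ^ 2 ^ (N - k)" for k
  have pow: "(P ^ 2 ^ m)\<^sup>2 = P ^ 2 ^ Suc m" for m
    by (simp add: mult.commute flip: power_mult)
  have "Suc (N - 1) = N"
    using N by simp
  then have "(r 1 * sqrt a)\<^sup>2 = v\<^sup>2 * (a * P ^ 2 ^ N)"
    using a pow[of "N - 1"] by (simp add: r_def power_mult_distrib del: power_Suc)
  also have "\<dots> \<le> v\<^sup>2 * (u / v)"
    using \<open>?L\<close> v by (intro mult_left_mono) auto
  finally have "(r 1 * sqrt a)\<^sup>2 \<le> u * v"
    using v by (simp add: power2_eq_square mult.commute)
  moreover have "(r (k + 1))\<^sup>2 \<le> r k * v" if "k \<in> {1..N - 1}" for k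
  proof -
    have "Suc (N - (k + 1)) = N - k"
      using that by auto
    then show ?thesis
      using pow[of "N - (k + 1)"] by (simp add: r_def power2_eq_square mult_ac)
  qed
  ultimately show ?R
    using v P by (intro exI[of _ r]) (auto simp: r_def)
next
  assume ?R
  then obtain r where first: "(r 1 * sqrt a)\<^sup>2 \<le> u * v"
    and step: "\<And>k. k \<in> {1..N - 1} \<Longrightarrow> (r (k + 1))\<^sup>2 \<le> r k * v"
    and last: "v * P \<le> r N"
    by auto
  \<comment> \<open>The induction runs backwards from \<open>r N\<close>, with \<open>m\<close>
    counting squarings, and stops at \<open>r 1\<close>. For \<open>N = 1\<close> only the base case
    occurs.\<close>
  have chain: "v * P ^ 2 ^ m \<le> r (N - m)" if "m \<le> N - 1" for m
    using that
  proof (induction m)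
    case 0
    then show ?case
      using last by simp
  next
    case (Suc m)
    define k where "k = N - Suc m"
    have k: "k \<in> {1..N - 1}" "N - m = k + 1"
      using Suc.prems by (auto simp: k_def)
    have "(v * P ^ 2 ^ m)\<^sup>2 \<le> (r (k + 1))\<^sup>2"
      using Suc k v P by (intro power_mono) auto
    also have "\<dots> \<le> r k * v"
      using step k by blast
    finally have "v * (v * P ^ 2 ^ Suc m) \<le> v * r k"
      by (simp add: power2_eq_square power_mult_distrib mult_2 power_add algebra_simps)
    then show ?case
      using v by (simp add: k_def)
  qed
  have N1: "N - (N - 1) = 1" "Suc (N - 1) = N"
    using N by auto
  have "v * P ^ 2 ^ (N - 1) \<le> r 1"
    using chain[of "N - 1"] N1 by simp
  then have "(v * P ^ 2 ^ (N - 1) * sqrt a)\<^sup>2 \<le> (r 1 * sqrt a)\<^sup>2"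
    using v P a by (intro power_mono mult_right_mono) auto
  also have "(v * P ^ 2 ^ (N - 1) * sqrt a)\<^sup>2 = v * v * (a * P ^ 2 ^ Suc (N - 1))"
    using a by (simp add: power_mult_distrib power2_eq_square mult_2 power_add)
  finally have "v * (v * (a * P ^ 2 ^ N)) \<le> v * u"
    using first N1 by (simp add: mult.commute mult.left_commute)
  then show ?L
    using v by (simp add: field_simps)
qed

lemma K_sc_2_eq:
  assumes M: "M > 1" and N: "N \<ge> 1"
  shows "K_sc M xh N 2 =
        {x \<in> box_dom M. \<exists>r :: nat \<Rightarrow> real.
           (\<forall>k\<in>{1..N - 1}. r k \<ge> 0) \<and>
           vector [2 * r 1 * sqrt (exp (xh $ 3 / xh $ 2)), x $ 1 - x $ 2, x $ 1 + x $ 2] \<in> L3 \<and>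
           (\<forall>k\<in>{1..N - 1}. vector [2 * r (k + 1), r k - x $ 2, r k + x $ 2] \<in> L3) \<and>
           vector [x $ 2 + (x $ 3 - x $ 2 * (xh $ 3 / xh $ 2)) / 2 ^ N, r N - x $ 2, r N] \<in> L3}"
proof -
  have "exp (xh $ 3 / xh $ 2) * psi_hat 2 ((x $ 3 / x $ 2 - xh $ 3 / xh $ 2) / 2 ^ N) ^ 2 ^ N
          \<le> x $ 1 / x $ 2 \<longleftrightarrow>
        (\<exists>r :: nat \<Rightarrow> real.
           (\<forall>k\<in>{1..N - 1}. r k \<ge> 0) \<and>
           vector [2 * r 1 * sqrt (exp (xh $ 3 / xh $ 2)), x $ 1 - x $ 2, x $ 1 + x $ 2] \<in> L3 \<and>
           (\<forall>k\<in>{1..N - 1}. vector [2 * r (k + 1), r k - x $ 2, r k + x $ 2] \<in> L3) \<and>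
           vector [x $ 2 + (x $ 3 - x $ 2 * (xh $ 3 / xh $ 2)) / 2 ^ N, r N - x $ 2, r N] \<in> L3)"
    if "x \<in> box_dom M" for x
  proof -
    define u v a where "u = x $ 1" and "v = x $ 2" and "a = exp (xh $ 3 / xh $ 2)"
    define z where "z = (x $ 3 / x $ 2 - xh $ 3 / xh $ 2) / 2 ^ N"
    have "1 / M > 0" "1 / M \<le> u" "1 / M \<le> v"
      using M that by (simp_all add: box_dom_def u_def v_def)
    then have uv: "u > 0" "v > 0"
      by linarith+
    have P: "psi_hat 2 z > 0"
      unfolding psi_hat_2 by (simp add: add_nonneg_pos)
    \<comment> \<open>Multiplying \<open>z\<close> by \<open>v = x $ 2\<close> clears its
      denominator, so this entry is affine in \<open>x\<close>.\<close>
    have w: "v + (x $ 3 - v * (xh $ 3 / xh $ 2)) / 2 ^ N = v + v * z"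
      using uv by (simp add: z_def v_def right_diff_distrib)
    have first: "vector [2 * r 1 * sqrt a, u - v, u + v] \<in> L3 \<longleftrightarrow> (r 1 * sqrt a)\<^sup>2 \<le> u * v"
      for r :: "nat \<Rightarrow> real"
      using rotated_cone_iff[of "r 1 * sqrt a" u v] uv by (simp add: mult.assoc)
    \<comment> \<open>The sign condition on \<open>r k\<close> supplies the nonnegativity of
      \<open>r k + v\<close> required by the rotated cone.\<close>
    have step: "vector [2 * r (k + 1), r k - v, r k + v] \<in> L3 \<longleftrightarrow> (r (k + 1))\<^sup>2 \<le> r k * v"
      if "r k \<ge> 0" for r :: "nat \<Rightarrow> real" and k
      using rotated_cone_iff[of "r (k + 1)" "r k" v] uv that by simp
    have "a > 0"
      by (simp add: a_def)
    note chain = squaring_chain_iff[OF uv(2) this P N, of u]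
    show ?thesis
      unfolding w u_def[symmetric] v_def[symmetric] a_def[symmetric]
        z_def[unfolded v_def[symmetric], symmetric] chain first psi_hat_2_cone_iff[OF uv(2)]
      by (intro ex_cong1) (auto simp: step simp del: One_nat_def add_Suc_right)
  qed
  then show ?thesis
    unfolding K_sc_def by blast
qed

text \<open>\<open>B\<close> is chosen from \<open>s\<close> alone, before \<open>M\<close>,
  \<open>xh\<close>, \<delta> and \<epsilon>, so the asymptotic bound is uniform in \<open>M\<close>
  and \<open>xh\<close>, and the same \<open>B\<close> serves every \<kappa>.\<close>

theorem theorem6:
  "(\<forall>s::nat. s \<ge> 1 \<longrightarrow>
     (\<exists>B :: real \<times> real \<Rightarrow> real.
        (\<forall>\<kappa>>0. B \<in> O[growth_filter \<kappa>](\<lambda>(\<delta>, t). ln (\<delta> / real s) + ln t / real s)) \<and>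
        (\<forall>M>1. \<forall>xh \<in> box_dom M. \<forall>\<delta>>0. \<forall>\<epsilon> \<in> {0<..\<delta>}.
           \<exists>N::nat. N \<ge> 1 \<and> real N \<le> B (\<delta>, 1 / \<epsilon>) \<and>
             K_exp M (- \<epsilon>) \<inter> slab xh \<delta> \<subseteq> K_sc M xh N (2 * s) \<inter> slab xh \<delta> \<and>
             K_sc M xh N (2 * s) \<inter> slab xh \<delta> \<subseteq> K_exp M \<epsilon> \<inter> slab xh \<delta>))) \<and>
   (\<forall>M>1. \<forall>xh \<in> box_dom M. \<forall>N::nat. N \<ge> 1 \<longrightarrow>
      K_sc M xh N (2 * 1) =
        {x \<in> box_dom M. \<exists>r :: nat \<Rightarrow> real.
           (\<forall>k\<in>{1..N - 1}. r k \<ge> 0) \<and>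
           vector [2 * r 1 * sqrt (exp (xh $ 3 / xh $ 2)), x $ 1 - x $ 2, x $ 1 + x $ 2] \<in> L3 \<and>
           (\<forall>k\<in>{1..N - 1}. vector [2 * r (k + 1), r k - x $ 2, r k + x $ 2] \<in> L3) \<and>
           vector [x $ 2 + (x $ 3 - x $ 2 * (xh $ 3 / xh $ 2)) / 2 ^ N, r N - x $ 2, r N] \<in> L3})"
proof (intro conjI allI impI ballI)
  fix s :: nat
  assume s: "s \<ge> 1"
  have "\<exists>N::nat. N \<ge> 1 \<and> real N \<le> 3 + max 0 (depth s (\<delta>, 1 / \<epsilon>)) \<and>
             K_exp M (- \<epsilon>) \<inter> slab xh \<delta> \<subseteq> K_sc M xh N (2 * s) \<inter> slab xh \<delta> \<and>
             K_sc M xh N (2 * s) \<inter> slab xh \<delta> \<subseteq> K_exp M \<epsilon> \<inter> slab xh \<delta>"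
    if "\<epsilon> \<in> {0<..\<delta>}" for M xh \<delta> \<epsilon>
  proof -
    \<comment> \<open>The maximum with 0 keeps \<open>N\<close> positive when \<open>depth\<close>
      is negative; rounding up adds less than 1, within the constant 3 of the bound.\<close>
    define N where "N = nat \<lceil>1 + max 0 (depth s (\<delta>, 1 / \<epsilon>))\<rceil>"
    have N: "real N \<ge> 1 + max 0 (depth s (\<delta>, 1 / \<epsilon>))"
            "real N \<le> 3 + max 0 (depth s (\<delta>, 1 / \<epsilon>))"
      unfolding N_def by linarith+
    then have "N \<ge> 1" "real N \<ge> 1 + depth s (\<delta>, 1 / \<epsilon>)"
      by linarith+
    with that have "\<delta> / 2 ^ N \<le> 1/2" "\<delta> * (\<delta> / 2 ^ N) ^ (2 * s) \<le> \<epsilon>"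
      using depth_sufficient[OF s] by auto
    then show ?thesis
      using K_sc_sandwich[of "2 * s" \<delta> N \<epsilon>] s N \<open>N \<ge> 1\<close> by (intro exI[of _ N]) auto
  qed
  then show "\<exists>B :: real \<times> real \<Rightarrow> real.
        (\<forall>\<kappa>>0. B \<in> O[growth_filter \<kappa>](\<lambda>(\<delta>, t). ln (\<delta> / real s) + ln t / real s)) \<and>
        (\<forall>M>1. \<forall>xh \<in> box_dom M. \<forall>\<delta>>0. \<forall>\<epsilon> \<in> {0<..\<delta>}.
           \<exists>N::nat. N \<ge> 1 \<and> real N \<le> B (\<delta>, 1 / \<epsilon>) \<and>
             K_exp M (- \<epsilon>) \<inter> slab xh \<delta> \<subseteq> K_sc M xh N (2 * s) \<inter> slab xh \<delta> \<and>
             K_sc M xh N (2 * s) \<inter> slab xh \<delta> \<subseteq> K_exp M \<epsilon> \<inter> slab xh \<delta>)"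
    using depth_bigo[OF s] by (intro exI[of _ "\<lambda>p. 3 + max 0 (depth s p)"]) blast
qed (simp only: mult_1_right K_sc_2_eq)

end
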